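(* Let $\nu>0$, $\lambda>0$, $\alpha>0$. Let $f\in C(\mathbb R,\ell_2)$ be translation-compact (i.e. $\{f^h : h\in\mathbb R\}$ is precompact in $C(\mathbb R,\ell_2)$), and let $F\in C(\mathbb R,\mathbb R)$ be Lipschitz continuous on bounded sets with $F(0)=0$ and $sF(s)\le -\alpha s^2$ for all $s\in\mathbb R$. For $(v,g)\in\ell_2\times H(f)$ let $\varphi(\cdot,v,g):[0,+\infty)\to\ell_2$ be the solution of $u'=\nu\Lambda u-\lambda u+\widetilde F(u)+g(t)$, $u(0)=v$. Then there exists a closed ball $B[0,r]:=\{\xi\in\ell_2 : \|\xi\|\le r\}$ such that for every bounded subset $B\subset\ell_2$ there exists a positive number $L=L(B)$ with $$\varphi(t,B,H(f))\subseteq B[0,r]\quad\text{for all } t\ge L(B),$$ where $\varphi(t,B,H(f)):=\{\varphi(t,u,g) : u\in B,\ g\in H(f)\}$.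
   Context: $\ell_2$ is the Hilbert space of real two-sided square-summable sequences $u=(u_i)_{i\in\mathbb Z}$ with norm $\|\cdot\|$. $(\Lambda u)_i:=u_{i-1}-2u_i+u_{i+1}$ (a bounded linear operator on $\ell_2$) and $\widetilde F(u)_i:=F(u_i)$ (which maps $\ell_2$ to $\ell_2$ when $F(0)=0$ and $F$ is Lipschitz on bounded sets). $C(\mathbb R,\ell_2)$ is the space of continuous functions $\mathbb R\to\ell_2$ with the compact-open topology (uniform convergence on compact intervals). $f^h(t):=f(t+h)$; $H(f)$ is the closure of $\{f^h: h\in\mathbb R\}$ in $C(\mathbb R,\ell_2)$. Under the stated hypotheses the initial value problem has a unique solution, defined on all of $[0,+\infty)$, for every $(v,g)\in\ell_2\times H(f)$. *)

theory Defs
  imports "HOL-Analysis.Analysis"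
begin

typedef l2seq = "{u :: int \<Rightarrow> real. (\<lambda>i. (u i)\<^sup>2) summable_on UNIV}"
  morphisms l2_nth Abs_l2seq
  by (rule exI[of _ "\<lambda>_. 0"]) simp

setup_lifting type_definition_l2seq

lemma l2_nth_summable: "(\<lambda>i. (l2_nth u i)\<^sup>2) summable_on UNIV"
  using l2_nth[of u] by simp

lemma l2seq_eqI: "(\<And>i. l2_nth u i = l2_nth v i) \<Longrightarrow> u = v"
  using l2_nth_inject by blast

lemma summable_on_dominated:
  fixes a b :: "'i \<Rightarrow> real"
  assumes "b summable_on A" "\<And>i. i \<in> A \<Longrightarrow> \<bar>a i\<bar> \<le> b i"
  shows "a summable_on A"
proof -
  have "(\<lambda>i. norm (a i)) summable_on A"
    by (rule summable_on_comparison_test[OF assms(1)]) (use assms(2) in auto)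
  then show ?thesis by (rule abs_summable_summable)
qed

lemma square_summable_mult:
  fixes a b :: "int \<Rightarrow> real"
  assumes "(\<lambda>i. (a i)\<^sup>2) summable_on UNIV" "(\<lambda>i. (b i)\<^sup>2) summable_on UNIV"
  shows "(\<lambda>i. a i * b i) summable_on UNIV"
proof (rule summable_on_dominated[OF summable_on_add[OF assms]])
  fix i
  have "0 \<le> (\<bar>a i\<bar> - \<bar>b i\<bar>)\<^sup>2" by simp
  then have "2 * (\<bar>a i\<bar> * \<bar>b i\<bar>) \<le> (a i)\<^sup>2 + (b i)\<^sup>2"
    by (simp add: power2_diff)
  moreover have "0 \<le> \<bar>a i\<bar> * \<bar>b i\<bar>" by simp
  ultimately show "\<bar>a i * b i\<bar> \<le> (a i)\<^sup>2 + (b i)\<^sup>2"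
    unfolding abs_mult by linarith
qed

lemma square_summable_add:
  fixes a b :: "int \<Rightarrow> real"
  assumes "(\<lambda>i. (a i)\<^sup>2) summable_on UNIV" "(\<lambda>i. (b i)\<^sup>2) summable_on UNIV"
  shows "(\<lambda>i. (a i + b i)\<^sup>2) summable_on UNIV"
proof -
  have "(\<lambda>i. (a i)\<^sup>2 + (b i)\<^sup>2 + 2 * (a i * b i)) summable_on UNIV"
    by (intro summable_on_add assms summable_on_cmult_right square_summable_mult)
  then show ?thesis by (simp add: power2_sum mult.assoc)
qed

lemma square_summable_scale:
  fixes a :: "int \<Rightarrow> real"
  assumes "(\<lambda>i. (a i)\<^sup>2) summable_on UNIV"
  shows "(\<lambda>i. (c * a i)\<^sup>2) summable_on UNIV"
  unfolding power_mult_distrib by (intro summable_on_cmult_right assms)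

lemma square_summable_shift:
  fixes a :: "int \<Rightarrow> real"
  assumes "(\<lambda>i. (a i)\<^sup>2) summable_on UNIV"
  shows "(\<lambda>i. (a (i + k))\<^sup>2) summable_on UNIV"
proof -
  have "bij_betw (\<lambda>i::int. i + k) UNIV UNIV"
    by (rule bij_betwI[where g = "\<lambda>i. i - k"]) auto
  from summable_on_reindex_bij_betw[OF this, of "\<lambda>i. (a i)\<^sup>2"] assms
  show ?thesis by simp
qed

instantiation l2seq :: real_inner
begin

lift_definition zero_l2seq :: l2seq is "\<lambda>_. 0" by simp

lift_definition plus_l2seq :: "l2seq \<Rightarrow> l2seq \<Rightarrow> l2seq" is "\<lambda>u v i. u i + v i"
  by (rule square_summable_add)

lift_definition uminus_l2seq :: "l2seq \<Rightarrow> l2seq" is "\<lambda>u i. - u i" by simp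

lift_definition minus_l2seq :: "l2seq \<Rightarrow> l2seq \<Rightarrow> l2seq" is "\<lambda>u v i. u i - v i"
  using square_summable_add[of _ "\<lambda>i. - _ i"] by simp

lift_definition scaleR_l2seq :: "real \<Rightarrow> l2seq \<Rightarrow> l2seq" is "\<lambda>c u i. c * u i"
  by (rule square_summable_scale)

definition inner_l2seq :: "l2seq \<Rightarrow> l2seq \<Rightarrow> real"
  where "inner_l2seq u v = (\<Sum>\<^sub>\<infinity>i. l2_nth u i * l2_nth v i)"

definition norm_l2seq :: "l2seq \<Rightarrow> real"
  where "norm_l2seq u = sqrt (\<Sum>\<^sub>\<infinity>i. (l2_nth u i)\<^sup>2)"

definition sgn_l2seq :: "l2seq \<Rightarrow> l2seq"
  where "sgn_l2seq u = inverse (norm u) *\<^sub>R u"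

definition dist_l2seq :: "l2seq \<Rightarrow> l2seq \<Rightarrow> real"
  where "dist_l2seq u v = norm (u - v)"

definition uniformity_l2seq :: "(l2seq \<times> l2seq) filter"
  where "uniformity_l2seq = (INF e\<in>{0<..}. principal {(x, y). dist x y < e})"

definition open_l2seq :: "l2seq set \<Rightarrow> bool"
  where "open_l2seq U \<longleftrightarrow> (\<forall>x\<in>U. \<forall>\<^sub>F (x', y) in uniformity. x' = x \<longrightarrow> y \<in> U)"

instance
proof
  fix u v w :: l2seq and a b :: real
  show "u + v + w = u + (v + w)" by transfer (simp add: add.assoc)
  show "u + v = v + u" by transfer (simp add: add.commute)
  show "0 + u = u" by transfer simp
  show "- u + u = 0" by transfer simp
  show "u - v = u + - v" by transfer simp
  show "a *\<^sub>R (u + v) = a *\<^sub>R u + a *\<^sub>R v" by transfer (simp add: algebra_simps)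
  show "(a + b) *\<^sub>R u = a *\<^sub>R u + b *\<^sub>R u" by transfer (simp add: algebra_simps)
  show "a *\<^sub>R b *\<^sub>R u = (a * b) *\<^sub>R u" by transfer (simp add: algebra_simps)
  show "1 *\<^sub>R u = u" by transfer simp
  show "sgn u = inverse (norm u) *\<^sub>R u" by (rule sgn_l2seq_def)
  show "dist u v = norm (u - v)" by (rule dist_l2seq_def)
  show "uniformity = (INF e\<in>{0<..}. principal {(x::l2seq, y). dist x y < e})"
    by (rule uniformity_l2seq_def)
  show "open U \<longleftrightarrow> (\<forall>x\<in>U. \<forall>\<^sub>F (x', y) in uniformity. x' = x \<longrightarrow> y \<in> U)" for U :: "l2seq set"
    by (rule open_l2seq_def)
  show "inner u v = inner v u" unfolding inner_l2seq_def by (simp add: mult.commute)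
  show "inner (u + v) w = inner u w + inner v w"
    unfolding inner_l2seq_def plus_l2seq.rep_eq distrib_right
    by (intro infsum_add square_summable_mult l2_nth_summable)
  show "inner (a *\<^sub>R u) v = a * inner u v"
    unfolding inner_l2seq_def scaleR_l2seq.rep_eq mult.assoc
    by (intro infsum_cmult_right square_summable_mult l2_nth_summable)
  show "0 \<le> inner u u" unfolding inner_l2seq_def by (intro infsum_nonneg) simp
  show "inner u u = 0 \<longleftrightarrow> u = 0"
  proof
    assume "inner u u = 0"
    then have "l2_nth u i * l2_nth u i = 0" for i
      by (intro nonneg_infsum_le_0D[where A = UNIV and f = "\<lambda>i. l2_nth u i * l2_nth u i"]
            square_summable_mult l2_nth_summable) (auto simp: inner_l2seq_def)
    then show "u = 0" by (intro l2seq_eqI) (simp add: zero_l2seq.rep_eq)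
  qed (simp add: inner_l2seq_def zero_l2seq.rep_eq)
  show "norm u = sqrt (inner u u)"
    by (simp add: norm_l2seq_def inner_l2seq_def power2_eq_square)
qed

end

lemma l2_nth_diff: "l2_nth (u - v) i = l2_nth u i - l2_nth v i"
  by (simp add: minus_l2seq.rep_eq)

lemma l2_norm_square: "(norm u)\<^sup>2 = (\<Sum>\<^sub>\<infinity>i. (l2_nth u i)\<^sup>2)"
  unfolding norm_l2seq_def by (simp add: infsum_nonneg)

lemma l2_partial_sum_le: "finite S \<Longrightarrow> (\<Sum>i\<in>S. (l2_nth u i)\<^sup>2) \<le> (norm u)\<^sup>2"
  unfolding l2_norm_square by (intro finite_sum_le_infsum l2_nth_summable) auto

lemma l2_nth_le_norm: "\<bar>l2_nth u i\<bar> \<le> norm u"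
  using l2_partial_sum_le[of "{i}" u] by (intro abs_le_square_iff[THEN iffD2, of _ "norm u", unfolded abs_norm_cancel]) simp

lemma l2_norm_leI:
  assumes "\<And>S. finite S \<Longrightarrow> (\<Sum>i\<in>S. (l2_nth u i)\<^sup>2) \<le> c\<^sup>2" "0 \<le> c"
  shows "norm u \<le> c"
proof -
  have "(norm u)\<^sup>2 \<le> c\<^sup>2"
    unfolding l2_norm_square by (rule infsum_le_finite_sums[OF l2_nth_summable assms(1)])
  then show ?thesis using assms(2) by (rule power2_le_imp_le)
qed

instance l2seq :: banach
proof
  fix X :: "nat \<Rightarrow> l2seq"
  assume C: "Cauchy X"
  have "Cauchy (\<lambda>n. l2_nth (X n) i)" for i
  proof (rule CauchyI)
    fix e :: real assume "e > 0"
    from CauchyD[OF C this] obtain N where N: "\<forall>m\<ge>N. \<forall>n\<ge>N. norm (X m - X n) < e" by blast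
    have "norm (l2_nth (X m) i - l2_nth (X n) i) < e" if "m \<ge> N" "n \<ge> N" for m n
      using l2_nth_le_norm[of "X m - X n" i] N that by (fastforce simp: l2_nth_diff)
    then show "\<exists>M. \<forall>m\<ge>M. \<forall>n\<ge>M. norm (l2_nth (X m) i - l2_nth (X n) i) < e" by blast
  qed
  then have "\<forall>i. \<exists>a. (\<lambda>n. l2_nth (X n) i) \<longlonglongrightarrow> a"
    by (simp add: Cauchy_convergent_iff convergent_def)
  then obtain a where a: "\<And>i. (\<lambda>n. l2_nth (X n) i) \<longlonglongrightarrow> a i" by metis
  from cauchy_imp_bounded[OF C] obtain M where M: "\<And>n. norm (X n) \<le> M"
    by (auto simp: bounded_iff)
  have "(\<Sum>i\<in>S. (a i)\<^sup>2) \<le> M\<^sup>2" if "finite S" for S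
  proof (rule LIMSEQ_le_const2)
    show "(\<lambda>n. \<Sum>i\<in>S. (l2_nth (X n) i)\<^sup>2) \<longlonglongrightarrow> (\<Sum>i\<in>S. (a i)\<^sup>2)"
      by (intro tendsto_intros a)
    show "\<exists>N. \<forall>n\<ge>N. (\<Sum>i\<in>S. (l2_nth (X n) i)\<^sup>2) \<le> M\<^sup>2"
      using l2_partial_sum_le[OF that] M by (meson norm_ge_zero order_trans power_mono)
  qed
  then have "(\<lambda>i. (a i)\<^sup>2) summable_on UNIV"
    by (intro nonneg_bounded_partial_sums_imp_summable_on[where C = "M\<^sup>2"])
      (auto intro!: eventually_finite_subsets_at_top_weakI)
  then obtain u where u: "\<And>i. l2_nth u i = a i"
    using Abs_l2seq_inverse[of a] by (metis mem_Collect_eq)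
  have "X \<longlonglongrightarrow> u"
  proof (rule LIMSEQ_I)
    fix e :: real assume "e > 0"
    then have "e / 2 > 0" by simp
    from CauchyD[OF C this] obtain N where N: "\<And>m n. m \<ge> N \<Longrightarrow> n \<ge> N \<Longrightarrow> norm (X m - X n) < e / 2"
      by blast
    have "norm (X n - u) < e" if n: "n \<ge> N" for n
    proof -
      have "norm (X n - u) \<le> e / 2"
      proof (rule l2_norm_leI)
        fix S :: "int set" assume S: "finite S"
        show "(\<Sum>i\<in>S. (l2_nth (X n - u) i)\<^sup>2) \<le> (e / 2)\<^sup>2"
        proof (rule LIMSEQ_le_const2)
          show "(\<lambda>m. \<Sum>i\<in>S. (l2_nth (X n - X m) i)\<^sup>2) \<longlonglongrightarrow> (\<Sum>i\<in>S. (l2_nth (X n - u) i)\<^sup>2)"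
            unfolding l2_nth_diff u by (intro tendsto_intros a)
          show "\<exists>M. \<forall>m\<ge>M. (\<Sum>i\<in>S. (l2_nth (X n - X m) i)\<^sup>2) \<le> (e / 2)\<^sup>2"
            using l2_partial_sum_le[OF S] N[OF n]
            by (meson less_imp_le norm_ge_zero order_trans power_mono)
        qed
      qed (use \<open>e > 0\<close> in simp)
      with \<open>e > 0\<close> show ?thesis by simp
    qed
    then show "\<exists>N. \<forall>n\<ge>N. norm (X n - u) < e" by blast
  qed
  then show "convergent X" by (auto simp: convergent_def)
qed

lift_definition l2_laplacian :: "l2seq \<Rightarrow> l2seq"
  is "\<lambda>u i. u (i - 1) - 2 * u i + u (i + 1)"
proof -
  fix u :: "int \<Rightarrow> real"
  assume u: "(\<lambda>i. (u i)\<^sup>2) summable_on UNIV"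
  have "(\<lambda>i. (u (i + (-1)) + (-2) * u i + u (i + 1))\<^sup>2) summable_on UNIV"
    by (intro square_summable_add square_summable_scale square_summable_shift u)
  then show "(\<lambda>i. (u (i - 1) - 2 * u i + u (i + 1))\<^sup>2) summable_on UNIV" by simp
qed

text \<open>The value is unspecified when the sequence \<open>(F (u\<^sub>i))\<^sub>i\<close> is not square-summable;
  \<open>l2_nth_superposition\<close> below shows that this does not happen if \<open>F\<close> vanishes at 0 and is
  Lipschitz on bounded sets.\<close>

definition superposition :: "(real \<Rightarrow> real) \<Rightarrow> l2seq \<Rightarrow> l2seq"
  where "superposition F u = Abs_l2seq (\<lambda>i. F (l2_nth u i))"

definition lipschitz_on_bounded_sets :: "('a::metric_space \<Rightarrow> 'b::metric_space) \<Rightarrow> bool"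
  where "lipschitz_on_bounded_sets F \<longleftrightarrow> (\<forall>S. bounded S \<longrightarrow> (\<exists>C. C-lipschitz_on S F))"

lemma l2_nth_superposition:
  assumes "lipschitz_on_bounded_sets F" "F 0 = 0"
  shows "l2_nth (superposition F u) i = F (l2_nth u i)"
proof -
  obtain C where C: "C-lipschitz_on (cball 0 (norm u)) F"
    using assms(1) bounded_cball unfolding lipschitz_on_bounded_sets_def by blast
  have "(F (l2_nth u i))\<^sup>2 \<le> (C * l2_nth u i)\<^sup>2" for i
  proof -
    have "dist (F (l2_nth u i)) (F 0) \<le> C * dist (l2_nth u i) 0"
      using l2_nth_le_norm[of u i] by (intro lipschitz_onD[OF C]) auto
    moreover have "C \<ge> 0" using C by (rule lipschitz_on_nonneg)
    ultimately show ?thesis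
      by (simp add: assms(2) abs_mult flip: abs_le_square_iff)
  qed
  then have "(\<lambda>i. (F (l2_nth u i))\<^sup>2) summable_on UNIV"
    by (intro summable_on_dominated[OF square_summable_scale[OF l2_nth_summable[of u], of C]])
      auto
  then show ?thesis unfolding superposition_def by (simp add: Abs_l2seq_inverse)
qed

definition compact_open_topology :: "('a::topological_space \<Rightarrow> 'b::topological_space) topology"
  where "compact_open_topology = topology_generated_by
    {{g. continuous_on UNIV g \<and> g ` K \<subseteq> U} | K U. compact K \<and> open U}"

lemma topspace_compact_open_topology:
  "topspace compact_open_topology = {g. continuous_on UNIV g}"
  unfolding compact_open_topology_def topology_generated_by_topspace
  by (auto intro!: exI[of _ "{}"])

definition translate :: "real \<Rightarrow> (real \<Rightarrow> 'a) \<Rightarrow> real \<Rightarrow> 'a"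
  where "translate h f = (\<lambda>t. f (t + h))"

definition hull_of :: "(real \<Rightarrow> 'a::topological_space) \<Rightarrow> (real \<Rightarrow> 'a) set"
  where "hull_of f = compact_open_topology closure_of (range (\<lambda>h. translate h f))"

text \<open>The set of translates is precompact in the sense of having compact closure.\<close>

definition translation_compact :: "(real \<Rightarrow> 'a::topological_space) \<Rightarrow> bool"
  where "translation_compact f \<longleftrightarrow>
    compactin compact_open_topology (hull_of f)"

text \<open>The derivative is taken in the norm of the sequence space; it is one-sided at 0.\<close>

definition solves_lattice_ivp ::
  "real \<Rightarrow> real \<Rightarrow> (real \<Rightarrow> real) \<Rightarrow> (real \<Rightarrow> l2seq) \<Rightarrow> l2seq \<Rightarrow> (real \<Rightarrow> l2seq) \<Rightarrow> bool"
  where "solves_lattice_ivp \<nu> lam F g v u \<longleftrightarrow> u 0 = v \<and>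
    (\<forall>t\<ge>0. (u has_vector_derivative
        (\<nu> *\<^sub>R l2_laplacian (u t) - lam *\<^sub>R u t + superposition F (u t) + g t)) (at t within {0..}))"

end

theory Submission
  imports Defs
begin

text \<open>Compactness of the hull bounds \<open>g t\<close> by one constant \<open>M\<close>, uniformly in \<open>t\<close> and in \<open>g\<close> from
  the hull. Since the discrete Laplacian is negative semidefinite and \<open>s * F s \<le> 0\<close>, the energy
  \<open>y = (norm u)\<^sup>2\<close> of a solution satisfies \<open>y' \<le> - 2 * lam * y + 2 * M * sqrt y \<le> - lam * y + M\<^sup>2 / lam\<close>,
  so \<open>y t \<le> (M / lam)\<^sup>2 + exp (- lam * t) * y 0\<close>.\<close>

lemma openin_compact_open_topology_subbasis:
  assumes "compact K" "open U"
  shows "openin compact_open_topology {g. continuous_on UNIV g \<and> g ` K \<subseteq> U}"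
  unfolding compact_open_topology_def using assms by (intro topology_generated_by_Basis) blast

lemma translate_in_hull_of:
  assumes "continuous_on UNIV f"
  shows "translate h f \<in> hull_of f"
proof -
  have "continuous_on UNIV (translate h f)" for h
    unfolding translate_def
    by (rule continuous_on_compose2[OF assms]) (auto intro!: continuous_intros)
  then have "range (\<lambda>h. translate h f) \<subseteq> topspace compact_open_topology"
    unfolding topspace_compact_open_topology by auto
  from closure_of_subset[OF this] show ?thesis unfolding hull_of_def by auto
qed

lemma hull_of_open_meets_translate:
  assumes "g \<in> hull_of f" "openin compact_open_topology U" "g \<in> U"
  obtains h where "translate h f \<in> U"
  using assms unfolding hull_of_def in_closure_of by blast

lemma hull_of_continuous: "g \<in> hull_of f \<Longrightarrow> continuous_on UNIV g"
  unfolding hull_of_def in_closure_of topspace_compact_open_topology by simp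

text \<open>Since \<open>{t}\<close> is compact, having a value at \<open>t\<close> outside
  \<open>C\<close> is a subbasic open condition. If it held at a hull element, some translate of
  \<open>f\<close> would satisfy it too, but the values of translates are values of
  \<open>f\<close>.\<close>

lemma hull_of_in_closed:
  assumes g: "g \<in> hull_of f" and "closed C" "\<And>t. f t \<in> C"
  shows "g t \<in> C"
proof (rule ccontr)
  let ?U = "{g. continuous_on UNIV g \<and> g ` {t} \<subseteq> - C}"
  assume "g t \<notin> C"
  then have gU: "g \<in> ?U" using hull_of_continuous[OF g] by simp
  have "openin compact_open_topology ?U"
    by (rule openin_compact_open_topology_subbasis) (use assms(2) in \<open>simp_all add: open_Compl\<close>)
  from hull_of_open_meets_translate[OF g this gU] obtain h where "translate h f \<in> ?U" .
  with assms(3) show False by (simp add: translate_def)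
qed

text \<open>The sets of functions whose value at \<open>x\<close> has norm below \<open>n\<close>
  form an increasing open cover; a finite subcover gives the bound.\<close>

lemma compactin_compact_open_bounded_eval:
  fixes H :: "('a::topological_space \<Rightarrow> 'b::real_normed_vector) set"
  assumes "compactin compact_open_topology H"
  shows "\<exists>M\<ge>0. \<forall>g\<in>H. norm (g x) \<le> M"
proof -
  let ?U = "\<lambda>n::nat. {g :: 'a \<Rightarrow> 'b. continuous_on UNIV g \<and> g ` {x} \<subseteq> ball 0 (real n)}"
  have "H \<subseteq> \<Union> (range ?U)"
    using compactin_subset_topspace[OF assms] reals_Archimedean2
    unfolding topspace_compact_open_topology by fastforce
  moreover have "openin compact_open_topology (?U n)" for n
    by (rule openin_compact_open_topology_subbasis) auto
  ultimately obtain \<F> where \<F>: "finite \<F>" "\<F> \<subseteq> range ?U" "H \<subseteq> \<Union> \<F>"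
    using assms unfolding compactin_def by (metis (no_types, lifting) imageE)
  from \<F>(1,2) obtain N where N: "finite N" "\<F> = ?U ` N"
    by (meson finite_subset_image)
  \<comment> \<open>The sum of the radii replaces their maximum, so an empty \<open>N\<close> needs
    no separate case.\<close>
  have "norm (g x) \<le> (\<Sum>n\<in>N. real n)" if g: "g \<in> H" for g
  proof -
    from g \<F>(3) N(2) obtain n where "n \<in> N" "norm (g x) < real n" by auto
    then show ?thesis using member_le_sum[of n N real] N(1) by auto
  qed
  then show ?thesis by (intro exI[of _ "\<Sum>n\<in>N. real n"]) (auto intro: sum_nonneg)
qed

text \<open>Evaluation at 0 is enough: \<open>translate t f\<close> lies in the hull and takes the
  value \<open>f t\<close> at 0, so the bound at 0 controls \<open>f\<close> at all times, and the
  closed ball passes this bound on to the whole hull.\<close>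

lemma translation_compact_hull_bounded:
  fixes f :: "real \<Rightarrow> 'a::real_normed_vector"
  assumes "continuous_on UNIV f" "translation_compact f"
  shows "\<exists>M\<ge>0. \<forall>g\<in>hull_of f. \<forall>t. norm (g t) \<le> M"
proof -
  obtain M where M: "M \<ge> 0" "\<And>g. g \<in> hull_of f \<Longrightarrow> norm (g 0) \<le> M"
    using compactin_compact_open_bounded_eval[of "hull_of f" 0] assms(2)
    unfolding translation_compact_def by blast
  have "f t \<in> cball 0 M" for t
    using M(2)[OF translate_in_hull_of[OF assms(1), of t]] by (simp add: translate_def)
  then have "norm (g t) \<le> M" if "g \<in> hull_of f" for g t
    using hull_of_in_closed[OF that closed_cball] by (metis mem_cball_0)
  with M(1) show ?thesis by blast
qed

lemma l2_norm_square_shift: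
  "(\<lambda>i. (l2_nth u (i + k))\<^sup>2) summable_on UNIV"
  "(\<Sum>\<^sub>\<infinity>i. (l2_nth u (i + k))\<^sup>2) = (norm u)\<^sup>2"
proof -
  have "bij_betw (\<lambda>i::int. i + k) UNIV UNIV"
    by (rule bij_betwI[where g = "\<lambda>i. i - k"]) auto
  from infsum_reindex_bij_betw[OF this, of "\<lambda>i. (l2_nth u i)\<^sup>2"]
  show "(\<Sum>\<^sub>\<infinity>i. (l2_nth u (i + k))\<^sup>2) = (norm u)\<^sup>2" by (simp add: l2_norm_square)
qed (rule square_summable_shift[OF l2_nth_summable])

text \<open>Young's inequality bounds each term by \<open>?b i\<close>, a combination of shifted
  squares with coefficients 1/2, 1/2 and -1. Each shift sums to the same squared norm, so the bounds
  add up to 0.\<close>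

lemma inner_l2_laplacian_le: "inner u (l2_laplacian u) \<le> 0"
proof -
  let ?a = "\<lambda>i. l2_nth u i"
  let ?b = "\<lambda>i. (1/2) * (?a (i + (-1)))\<^sup>2 + (1/2) * (?a (i + 1))\<^sup>2 + (-1) * (?a i)\<^sup>2"
  have "inner u (l2_laplacian u) \<le> (\<Sum>\<^sub>\<infinity>i. ?b i)"
    unfolding inner_l2seq_def
  proof (rule infsum_mono)
    show "(\<lambda>i. ?a i * l2_nth (l2_laplacian u) i) summable_on UNIV"
      by (intro square_summable_mult l2_nth_summable)
    show "?b summable_on UNIV"
      by (intro summable_on_add summable_on_cmult_right l2_norm_square_shift(1) l2_nth_summable)
    fix i
    \<comment> \<open>Half of this sum of squares is exactly the gap between the two sides.\<close>
    have "0 \<le> (?a (i - 1) - ?a i)\<^sup>2 + (?a (i + 1) - ?a i)\<^sup>2" by simp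
    then show "?a i * l2_nth (l2_laplacian u) i \<le> ?b i"
      by (simp add: l2_laplacian.rep_eq power2_eq_square algebra_simps)
  qed
  also have "\<dots> = 0"
    by (simp only: infsum_add infsum_cmult_right l2_norm_square_shift l2_nth_summable
        summable_on_add summable_on_cmult_right flip: l2_norm_square)
  finally show ?thesis .
qed

lemma inner_superposition_le:
  assumes "lipschitz_on_bounded_sets F" "F 0 = 0" "\<And>s. s * F s \<le> 0"
  shows "inner u (superposition F u) \<le> 0"
proof -
  have "inner u (superposition F u) \<le> (\<Sum>\<^sub>\<infinity>i::int. 0)"
    unfolding inner_l2seq_def
    by (intro infsum_mono square_summable_mult l2_nth_summable summable_on_0)
      (simp_all add: l2_nth_superposition[OF assms(1,2)] assms(3))
  then show ?thesis by simp
qed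

text \<open>Gronwall's inequality by an integrating factor: \<open>exp (a * s) * (y s - c)\<close>
  has nonpositive derivative.\<close>

lemma affine_decay_bound:
  fixes y y' :: "real \<Rightarrow> real"
  assumes der: "\<And>t. 0 \<le> t \<Longrightarrow> (y has_real_derivative y' t) (at t within {0..})"
    and le: "\<And>t. 0 \<le> t \<Longrightarrow> y' t \<le> a * (c - y t)"
    and "0 \<le> t"
  shows "y t - c \<le> exp (- a * t) * (y 0 - c)"
proof -
  define z where "z s = exp (a * s) * (y s - c)" for s
  have dz: "(z has_real_derivative exp (a * s) * (y' s - a * (c - y s))) (at s within {0..})"
    if "0 \<le> s" for s
    unfolding z_def using der[OF that]
    by (auto intro!: derivative_eq_intros simp: algebra_simps)
  have "z t \<le> z 0"
  proof (rule DERIV_nonpos_imp_decreasing_open[OF \<open>0 \<le> t\<close>])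
    fix s assume s: "0 < s" "s < t"
    \<comment> \<open>The derivative is one-sided only at 0; interior points carry a full
      derivative, and continuity covers the endpoints.\<close>
    have "at s within {0..} = at s"
      using s by (intro at_within_interior) simp
    with dz[of s] s have "(z has_real_derivative exp (a * s) * (y' s - a * (c - y s))) (at s)"
      by simp
    moreover have "exp (a * s) * (y' s - a * (c - y s)) \<le> 0"
      using le[of s] s by (simp add: mult_le_0_iff)
    ultimately show "\<exists>d. (z has_real_derivative d) (at s) \<and> d \<le> 0" by blast
  next
    have "continuous_on {0..} z"
      by (intro DERIV_continuous_on[where D = "\<lambda>s. exp (a * s) * (y' s - a * (c - y s))"] dz) simp
    then show "continuous_on {0..t} z" by (rule continuous_on_subset) auto
  qed
  then have "exp (- a * t) * z t \<le> exp (- a * t) * (y 0 - c)"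
    by (simp add: z_def)
  then show ?thesis
    by (simp add: z_def exp_minus mult.assoc[symmetric])
qed

text \<open>The right-hand side sees \<open>g\<close> only through \<open>M\<close> and
  \<open>v\<close> only through its norm, which makes the absorption time uniform over the hull and
  over bounded sets.\<close>

lemma lattice_solution_norm_bound:
  assumes "\<nu> \<ge> 0" "lam > 0"
    and F: "lipschitz_on_bounded_sets F" "F 0 = 0" "\<And>s. s * F s \<le> 0"
    and sol: "solves_lattice_ivp \<nu> lam F g v u"
    and g: "\<And>t. norm (g t) \<le> M"
    and "0 \<le> t"
  shows "(norm (u t))\<^sup>2 \<le> (M / lam)\<^sup>2 + exp (- lam * t) * (norm v)\<^sup>2"
proof -
  define w where
    "w s = \<nu> *\<^sub>R l2_laplacian (u s) - lam *\<^sub>R u s + superposition F (u s) + g s" for s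
  define y where "y s = (norm (u s))\<^sup>2" for s
  have u: "(u has_vector_derivative w s) (at s within {0..})" if "0 \<le> s" for s
    using sol that unfolding solves_lattice_ivp_def w_def by blast
  have y: "(y has_real_derivative 2 * inner (u s) (w s)) (at s within {0..})" if "0 \<le> s" for s
    unfolding y_def power2_norm_eq_inner has_real_derivative_iff_has_vector_derivative
    using u[OF that] unfolding has_vector_derivative_def
    by (auto intro!: derivative_eq_intros simp: inner_commute algebra_simps)
  have le: "2 * inner (u s) (w s) \<le> lam * ((M / lam)\<^sup>2 - y s)" for s
  proof -
    have "inner (u s) (w s) = \<nu> * inner (u s) (l2_laplacian (u s)) - lam * y s
        + inner (u s) (superposition F (u s)) + inner (u s) (g s)"
      by (simp add: w_def y_def inner_add_right inner_diff_right power2_norm_eq_inner)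
    moreover have "\<nu> * inner (u s) (l2_laplacian (u s)) \<le> 0"
      using inner_l2_laplacian_le[of "u s"] \<open>\<nu> \<ge> 0\<close> by (simp add: mult_le_0_iff)
    moreover have "inner (u s) (superposition F (u s)) \<le> 0"
      by (rule inner_superposition_le[OF F])
    moreover have "inner (u s) (g s) \<le> norm (u s) * M"
      using norm_cauchy_schwarz[of "u s" "g s"] g[of s] mult_left_mono[of "norm (g s)" M "norm (u s)"]
      by simp
    \<comment> \<open>Completing the square spends half of the damping \<open>2 * lam * y s\<close>
      on the forcing and leaves the rate \<open>lam\<close>.\<close>
    moreover have "2 * (norm (u s) * M) \<le> lam * y s + lam * (M / lam)\<^sup>2"
    proof -
      have "0 \<le> lam * (norm (u s) - M / lam)\<^sup>2" using \<open>lam > 0\<close> by simp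
      then show ?thesis
        using \<open>lam > 0\<close> by (simp add: y_def power2_diff algebra_simps)
    qed
    ultimately show ?thesis by (simp add: right_diff_distrib)
  qed
  have "y t - (M / lam)\<^sup>2 \<le> exp (- lam * t) * (y 0 - (M / lam)\<^sup>2)"
    by (rule affine_decay_bound[OF y le \<open>0 \<le> t\<close>])
  also have "\<dots> \<le> exp (- lam * t) * y 0" by (intro mult_left_mono) auto
  finally show ?thesis
    using sol unfolding solves_lattice_ivp_def by (simp add: y_def)
qed

theorem theorem3p1:
  fixes \<nu> lam \<alpha> :: real
    and f :: "real \<Rightarrow> l2seq"
    and F :: "real \<Rightarrow> real"
    and \<phi> :: "real \<Rightarrow> l2seq \<Rightarrow> (real \<Rightarrow> l2seq) \<Rightarrow> l2seq"
  assumes "\<nu> > 0" and "lam > 0" and "\<alpha> > 0"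
    and "continuous_on UNIV f" and "translation_compact f"
    and "continuous_on UNIV F" and "lipschitz_on_bounded_sets F" and "F 0 = 0"
    and "\<And>s. s * F s \<le> - \<alpha> * s\<^sup>2"
    and "\<And>v g. g \<in> hull_of f \<Longrightarrow> solves_lattice_ivp \<nu> lam F g v (\<lambda>t. \<phi> t v g)"
  shows "\<exists>r>0. \<forall>B. bounded B \<longrightarrow>
    (\<exists>L>0. \<forall>t\<ge>L. {\<phi> t u g | u g. u \<in> B \<and> g \<in> hull_of f} \<subseteq> cball 0 r)"
proof -
  obtain M where M: "M \<ge> 0" "\<And>g t. g \<in> hull_of f \<Longrightarrow> norm (g t) \<le> M"
    using translation_compact_hull_bounded[OF assms(4,5)] by blast
  have F: "s * F s \<le> 0" for s
  proof -
    have "0 \<le> \<alpha> * s\<^sup>2" using \<open>\<alpha> > 0\<close> by simp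
    with assms(9)[of s] show ?thesis by linarith
  qed
  \<comment> \<open>\<open>M / lam\<close> is the asymptotic bound; the extra 1 leaves room for the
    decaying transient, so the radius does not depend on \<open>B\<close>.\<close>
  have absorb: "\<exists>L>0. \<forall>t\<ge>L. {\<phi> t u g | u g. u \<in> B \<and> g \<in> hull_of f} \<subseteq> cball 0 (M / lam + 1)"
    if B: "bounded B" for B
  proof -
    obtain R where R: "\<And>u. u \<in> B \<Longrightarrow> norm u \<le> R" using B by (auto simp: bounded_iff)
    have "norm (\<phi> t u g) \<le> M / lam + 1"
      if t: "t \<ge> R\<^sup>2 / lam + 1" and u: "u \<in> B" and g: "g \<in> hull_of f" for t u g
    proof -
      have t': "R\<^sup>2 / lam \<le> t" using t by simp
      have "0 \<le> R\<^sup>2 / lam" using \<open>lam > 0\<close> by simp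
      with t' have t0: "0 \<le> t" by linarith
      have "(norm u)\<^sup>2 \<le> R\<^sup>2" using R[OF u] by (intro power_mono) auto
      also have "\<dots> \<le> lam * t" using t' \<open>lam > 0\<close> by (simp add: field_simps)
      also have "\<dots> \<le> exp (lam * t)" using exp_ge_add_one_self[of "lam * t"] by linarith
      finally have "exp (- lam * t) * (norm u)\<^sup>2 \<le> 1"
        by (simp add: exp_minus field_simps)
      then have "(norm (\<phi> t u g))\<^sup>2 \<le> (M / lam)\<^sup>2 + 1"
        using lattice_solution_norm_bound[OF _ \<open>lam > 0\<close> assms(7,8) F assms(10)[OF g] M(2)[OF g] t0]
          \<open>\<nu> > 0\<close> by (smt (verit))
      also have "\<dots> \<le> (M / lam + 1)\<^sup>2"
        using M(1) \<open>lam > 0\<close> by (simp add: power2_sum)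
      finally show ?thesis
        by (rule power2_le_imp_le) (use M(1) \<open>lam > 0\<close> in simp)
    qed
    moreover have "0 < R\<^sup>2 / lam + 1" using \<open>lam > 0\<close> by (simp add: add_nonneg_pos)
    ultimately show ?thesis by (intro exI[of _ "R\<^sup>2 / lam + 1"]) auto
  qed
  moreover have "M / lam + 1 > 0" using M(1) \<open>lam > 0\<close> by (simp add: add_nonneg_pos)
  ultimately show ?thesis by blast
qed

end
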